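(* Let $m_1,m_2>0$ with $2m_1+m_2=3$ and $E<0$, let $\gamma$ be Broucke's $T$-periodic orbit of the Hamiltonian system with Hamiltonian $\Gamma$, and let $K$ be the $4\times4$ matrix associated with $\gamma$ as in the context. Then $K$ has right eigenvector $[1,0,0,0]^T$ with eigenvalue $-1$.
   Context: Coordinates are $z=(Q_1,Q_2,Q_3,Q_4,P_1,P_2,P_3,P_4)\in\mathbb{R}^8$. Put $\mu=\frac12+\frac{m_1}{m_2}$ and $\mathbf{Q}=(Q_1^2-Q_2^2)Q_3+2Q_1Q_2Q_4$. The regularized Hamiltonian is $$\Gamma=\frac{P_1^2+P_2^2}{4m_1}+(P_3^2+P_4^2)(Q_1^2+Q_2^2)\left(\frac1{m_1}+\frac2{m_2}\right)-\frac{m_1m_2(Q_1^2+Q_2^2)}{\sqrt{\frac14(Q_1^2+Q_2^2)^2+\mu\mathbf{Q}+\mu^2(Q_3^2+Q_4^2)}}-\frac{m_1m_2(Q_1^2+Q_2^2)}{\sqrt{\frac14(Q_1^2+Q_2^2)^2-\mu\mathbf{Q}+\mu^2(Q_3^2+Q_4^2)}}-m_1^2-E(Q_1^2+Q_2^2),$$ defined where both radicands are positive. The Hamiltonian system is $z'=J\nabla\Gamma(z)$, $'=d/ds$, with $J=\begin{bmatrix}O&I\\-I&O\end{bmatrix}$ ($4\times4$ blocks). Broucke's orbit $\gamma$ is a $T$-periodic solution with $\gamma(0)=(0,0,0,\zeta_4,2m_1^{3/2},0,0,0)$ and $\gamma(T/4)=(\zeta_1,0,0,0,0,0,0,\zeta_8)$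 for some nonzero real $\zeta_1,\zeta_4,\zeta_8$. It satisfies $\gamma(s)=-S\gamma(T/2-s)=S\gamma(T-s)$ for all $s$, where $S=\operatorname{diag}(-1,1,-1,1,1,-1,1,-1)$, and it satisfies $Q_2=Q_3=P_2=P_3=0$ for all $s$. Let $e_1,\dots,e_8$ be the standard basis of $\mathbb{R}^8$. $Y_0$ is the (orthogonal and symplectic) matrix whose columns, in order, are $-e_5,\,-e_7,\,e_2,\,e_4,\,e_1,\,e_3,\,e_6,\,e_8$. It satisfies $-Y_0^{-1}SY_0=\operatorname{diag}(-I,I)$ ($4\times 4$ blocks). Let $Y(s)$ be the matrix solution of $\xi'=JD^2\Gamma(\gamma(s))\xi$, $\xi(0)=Y_0$, where $D^2\Gamma$ is the Hessian. Set $B=Y(T/4)$ and $W=Y_0^{-1}SY_0B^{-1}SB$. Then $W$ is symplectic and there are $4\times4$ matrices $K,L_1,L_2$ with $$W=\begin{bmatrix}K^T&L_1\\L_2&K\end{bmatrix},\qquad \tfrac12(W+W^{-1})=\begin{bmatrix}K^T&0\\0&K\end{bmatrix};$$ this defines $K$ (the lower-right $4\times4$ block of $W$). *)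

theory Defs
  imports "HOL-Analysis.Analysis"
begin

section \<open>Phase space and block matrices\<close>

text \<open>
  The phase space of dimension 8 is \<open>real ^ (4 + 4)\<close>, indexed by a disjoint sum, so that
  \<open>Inl i\<close> is the coordinate \<open>Q_i\<close> (number \<open>i\<close>) and \<open>Inr i\<close> is the coordinate \<open>P_i\<close>
  (number \<open>4 + i\<close>), for \<open>i = 1, 2, 3, 4\<close>.  The numeral \<open>4\<close> of the index type \<open>4\<close> equals \<open>0\<close>,
  but \<open>1, 2, 3, 4\<close> are still its four distinct elements.
\<close>

type_synonym phase = "real ^ (4 + 4)"
type_synonym mat8 = "real ^ (4 + 4) ^ (4 + 4)"

abbreviation Q :: "4 \<Rightarrow> phase \<Rightarrow> real" where "Q i z \<equiv> z $ Inl i"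
abbreviation P :: "4 \<Rightarrow> phase \<Rightarrow> real" where "P i z \<equiv> z $ Inr i"

definition phase_point :: "real ^ 4 \<Rightarrow> real ^ 4 \<Rightarrow> phase" where
  "phase_point q p = (\<chi> i. case i of Inl a \<Rightarrow> q $ a | Inr a \<Rightarrow> p $ a)"

abbreviation eQ :: "4 \<Rightarrow> phase" where "eQ i \<equiv> axis (Inl i) 1"
abbreviation eP :: "4 \<Rightarrow> phase" where "eP i \<equiv> axis (Inr i) 1"

definition block_matrix ::
  "real ^ 4 ^ 4 \<Rightarrow> real ^ 4 ^ 4 \<Rightarrow> real ^ 4 ^ 4 \<Rightarrow> real ^ 4 ^ 4 \<Rightarrow> mat8" where
  "block_matrix A B C D =
     (\<chi> i j. case i of
        Inl a \<Rightarrow> (case j of Inl b \<Rightarrow> A $ a $ b | Inr b \<Rightarrow> B $ a $ b)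
      | Inr a \<Rightarrow> (case j of Inl b \<Rightarrow> C $ a $ b | Inr b \<Rightarrow> D $ a $ b))"

definition lower_right_block :: "mat8 \<Rightarrow> real ^ 4 ^ 4" where
  "lower_right_block M = (\<chi> i j. M $ Inr i $ Inr j)"

definition diag_matrix :: "real ^ 'n \<Rightarrow> real ^ 'n ^ 'n" where
  "diag_matrix d = (\<chi> i j. if i = j then d $ i else 0)"

definition J :: mat8 where
  "J = block_matrix 0 (mat 1) (- mat 1) 0"

definition S :: mat8 where
  "S = diag_matrix (phase_point (vector [-1, 1, -1, 1]) (vector [1, -1, 1, -1]))"

text \<open>The columns of \<open>Y0\<close> are, in order, \<open>-e5, -e7, e2, e4, e1, e3, e6, e8\<close>.\<close>

definition Y0_column :: "4 + 4 \<Rightarrow> phase" where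
  "Y0_column j = (case j of
      Inl b \<Rightarrow> (vector [- eP 1, - eP 3, eQ 2, eQ 4] :: phase ^ 4) $ b
    | Inr b \<Rightarrow> (vector [eQ 1, eQ 3, eP 2, eP 4] :: phase ^ 4) $ b)"

definition Y0 :: mat8 where
  "Y0 = (\<chi> i j. Y0_column j $ i)"

section \<open>Gradient, Hessian and eigenvectors\<close>

definition gradient :: "(real ^ 'n \<Rightarrow> real) \<Rightarrow> real ^ 'n \<Rightarrow> real ^ 'n" where
  "gradient f z = (\<chi> i. frechet_derivative f (at z) (axis i 1))"

definition hessian :: "(real ^ 'n \<Rightarrow> real) \<Rightarrow> real ^ 'n \<Rightarrow> real ^ 'n ^ 'n" where
  "hessian f z = jacobian (gradient f) (at z)"

definition right_eigenvector :: "real ^ 'n ^ 'n \<Rightarrow> real ^ 'n \<Rightarrow> real \<Rightarrow> bool" where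
  "right_eigenvector A v l \<longleftrightarrow> v \<noteq> 0 \<and> A *v v = l *\<^sub>R v"

section \<open>The regularized Hamiltonian\<close>

definition mu :: "real \<Rightarrow> real \<Rightarrow> real" where
  "mu m1 m2 = 1/2 + m1 / m2"

definition bQ :: "phase \<Rightarrow> real" where
  "bQ z = ((Q 1 z)\<^sup>2 - (Q 2 z)\<^sup>2) * Q 3 z + 2 * Q 1 z * Q 2 z * Q 4 z"

definition radicand_plus :: "real \<Rightarrow> real \<Rightarrow> phase \<Rightarrow> real" where
  "radicand_plus m1 m2 z =
     1/4 * ((Q 1 z)\<^sup>2 + (Q 2 z)\<^sup>2)\<^sup>2 + mu m1 m2 * bQ z
       + (mu m1 m2)\<^sup>2 * ((Q 3 z)\<^sup>2 + (Q 4 z)\<^sup>2)"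

definition radicand_minus :: "real \<Rightarrow> real \<Rightarrow> phase \<Rightarrow> real" where
  "radicand_minus m1 m2 z =
     1/4 * ((Q 1 z)\<^sup>2 + (Q 2 z)\<^sup>2)\<^sup>2 - mu m1 m2 * bQ z
       + (mu m1 m2)\<^sup>2 * ((Q 3 z)\<^sup>2 + (Q 4 z)\<^sup>2)"

definition Gamma_dom :: "real \<Rightarrow> real \<Rightarrow> phase set" where
  "Gamma_dom m1 m2 = {z. radicand_plus m1 m2 z > 0 \<and> radicand_minus m1 m2 z > 0}"

text \<open>\<open>Gamma\<close> is meaningful only on the open set \<open>Gamma_dom\<close>.\<close>

definition Gamma :: "real \<Rightarrow> real \<Rightarrow> real \<Rightarrow> phase \<Rightarrow> real" where
  "Gamma m1 m2 E z =
     ((P 1 z)\<^sup>2 + (P 2 z)\<^sup>2) / (4 * m1)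
     + ((P 3 z)\<^sup>2 + (P 4 z)\<^sup>2) * ((Q 1 z)\<^sup>2 + (Q 2 z)\<^sup>2) * (1 / m1 + 2 / m2)
     - m1 * m2 * ((Q 1 z)\<^sup>2 + (Q 2 z)\<^sup>2) / sqrt (radicand_plus m1 m2 z)
     - m1 * m2 * ((Q 1 z)\<^sup>2 + (Q 2 z)\<^sup>2) / sqrt (radicand_minus m1 m2 z)
     - m1\<^sup>2 - E * ((Q 1 z)\<^sup>2 + (Q 2 z)\<^sup>2)"

section \<open>The orbit, its linearization and the matrix K\<close>

definition hamiltonian_solution ::
  "real \<Rightarrow> real \<Rightarrow> real \<Rightarrow> (real \<Rightarrow> phase) \<Rightarrow> bool" where
  "hamiltonian_solution m1 m2 E z \<longleftrightarrow>
     (\<forall>s. z s \<in> Gamma_dom m1 m2 \<and>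
          (z has_vector_derivative J *v gradient (Gamma m1 m2 E) (z s)) (at s))"

definition broucke_orbit ::
  "real \<Rightarrow> real \<Rightarrow> real \<Rightarrow> real \<Rightarrow> (real \<Rightarrow> phase) \<Rightarrow> bool" where
  "broucke_orbit m1 m2 E T \<gamma> \<longleftrightarrow>
     hamiltonian_solution m1 m2 E \<gamma> \<and>
     T > 0 \<and> (\<forall>s. \<gamma> (s + T) = \<gamma> s) \<and>
     (\<exists>\<zeta>1 \<zeta>4 \<zeta>8. \<zeta>1 \<noteq> 0 \<and> \<zeta>4 \<noteq> 0 \<and> \<zeta>8 \<noteq> 0 \<and>
        \<gamma> 0 = phase_point (vector [0, 0, 0, \<zeta>4]) (vector [2 * m1 powr (3/2), 0, 0, 0]) \<and>
        \<gamma> (T/4) = phase_point (vector [\<zeta>1, 0, 0, 0]) (vector [0, 0, 0, \<zeta>8])) \<and>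
     (\<forall>s. \<gamma> s = - (S *v \<gamma> (T/2 - s)) \<and> \<gamma> s = S *v \<gamma> (T - s)) \<and>
     (\<forall>s. Q 2 (\<gamma> s) = 0 \<and> Q 3 (\<gamma> s) = 0 \<and> P 2 (\<gamma> s) = 0 \<and> P 3 (\<gamma> s) = 0)"

definition linearized_solution ::
  "real \<Rightarrow> real \<Rightarrow> real \<Rightarrow> (real \<Rightarrow> phase) \<Rightarrow> (real \<Rightarrow> mat8) \<Rightarrow> bool" where
  "linearized_solution m1 m2 E \<gamma> Y \<longleftrightarrow>
     Y 0 = Y0 \<and>
     (\<forall>s. (Y has_vector_derivative J ** hessian (Gamma m1 m2 E) (\<gamma> s) ** Y s) (at s))"

definition W_matrix :: "mat8 \<Rightarrow> mat8" where
  "W_matrix B = matrix_inv Y0 ** S ** Y0 ** matrix_inv B ** S ** B"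

definition K_matrix :: "mat8 \<Rightarrow> real ^ 4 ^ 4" where
  "K_matrix B = lower_right_block (W_matrix B)"

end

theory Submission
  imports Defs
begin

text \<open>
  The velocity of the orbit, \<open>\<gamma>' = J \<nabla>\<Gamma>(\<gamma>)\<close>, is itself a solution of the linearized equation, and
  everything follows from its values at the two symmetric times \<open>0\<close> and \<open>T/4\<close>.

  At time \<open>0\<close> the orbit has \<open>Q_1 = Q_2 = 0\<close>. Apart from a kinetic term and a constant, \<open>\<Gamma>\<close> has the
  factor \<open>Q_1\<^sup>2 + Q_2\<^sup>2\<close>, which vanishes there to second order; so only the kinetic term contributes
  to the gradient (\<open>gradient_Gamma_where_Q1_Q2_zero\<close>), and \<open>\<gamma>'(0) = c e_1\<close> with \<open>c \<noteq> 0\<close>. The fifth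
  column of \<open>Y_0\<close> is \<open>e_1\<close>, so by uniqueness for linear equations (\<open>linear_ode_unique\<close>) the fifth column
  of \<open>c Y(s)\<close> is \<open>\<gamma>'(s)\<close>. At \<open>s = T/4\<close> this reads \<open>c B e_5 = \<gamma>'(T/4)\<close>.

  The symmetry \<open>\<gamma>(s) = -S \<gamma>(T/2 - s)\<close> reverses time about \<open>T/4\<close>. Differentiating it at \<open>T/4\<close> produces
  a second sign, hence \<open>S \<gamma>'(T/4) = \<gamma>'(T/4)\<close> (\<open>velocity_fixed_by_reflection\<close>). Therefore \<open>B e_5\<close> is
  fixed by \<open>S\<close>, so \<open>B\<^sup>-\<^sup>1 S B e_5 = e_5\<close>; and \<open>Y_0\<^sup>-\<^sup>1 S Y_0 e_5 = Y_0\<^sup>-\<^sup>1 S e_1 = - e_5\<close>. Together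
  \<open>W e_5 = - e_5\<close>, and the lower half of this identity is the claim about the first column of \<open>K\<close>.

  The analytic content is that \<open>\<Gamma>\<close> is twice continuously differentiable where the radicands are
  positive: this makes the Hessian the derivative of the gradient, so that \<open>\<gamma>'\<close> can be
  differentiated by the chain rule, and makes the coefficient matrix \<open>J D\<^sup>2\<Gamma>(\<gamma>(s))\<close> continuous in \<open>s\<close>,
  which gives uniqueness and the invertibility of \<open>B\<close>.
\<close>

section \<open>Twice continuously differentiable functions\<close>

text \<open>
  Continuity of the derivative is demanded direction by direction. On a finite-dimensional space this is
  the same as continuity in operator norm, and it avoids bundling derivatives as bounded linear maps.
\<close>

definition C1_on :: "'a::real_inner set \<Rightarrow> ('a \<Rightarrow> 'b::real_normed_vector) \<Rightarrow> bool" where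
  "C1_on U f \<longleftrightarrow>
     (\<exists>D. (\<forall>z\<in>U. (f has_derivative D z) (at z)) \<and> (\<forall>h. continuous_on U (\<lambda>z. D z h)))"

definition C2_on :: "'a::real_inner set \<Rightarrow> ('a \<Rightarrow> real) \<Rightarrow> bool" where
  "C2_on U f \<longleftrightarrow> (\<exists>G. (\<forall>z\<in>U. GDERIV f z :> G z) \<and> C1_on U G)"

lemma C1_on_imp_continuous_on:
  assumes "C1_on U f" shows "continuous_on U f"
  using assms unfolding C1_on_def
  by (meson continuous_at_imp_continuous_on has_derivative_continuous)

lemma C1_on_const: "C1_on U (\<lambda>z. c)"
  unfolding C1_on_def by (rule exI[of _ "\<lambda>z h. 0"]) auto

lemma C1_on_add:
  assumes "C1_on U f" "C1_on U g" shows "C1_on U (\<lambda>z. f z + g z)"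
proof -
  obtain Df where Df: "\<And>z. z \<in> U \<Longrightarrow> (f has_derivative Df z) (at z)"
      "\<And>h. continuous_on U (\<lambda>z. Df z h)"
    using assms(1) unfolding C1_on_def by blast
  obtain Dg where Dg: "\<And>z. z \<in> U \<Longrightarrow> (g has_derivative Dg z) (at z)"
      "\<And>h. continuous_on U (\<lambda>z. Dg z h)"
    using assms(2) unfolding C1_on_def by blast
  show ?thesis
    unfolding C1_on_def
    by (rule exI[of _ "\<lambda>z h. Df z h + Dg z h"])
       (auto intro!: has_derivative_add continuous_on_add Df Dg)
qed

lemma C1_on_scaleR:
  assumes "C1_on U f" "C1_on U g" shows "C1_on U (\<lambda>z. f z *\<^sub>R g z)"
proof -
  obtain Df where Df: "\<And>z. z \<in> U \<Longrightarrow> (f has_derivative Df z) (at z)"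
      "\<And>h. continuous_on U (\<lambda>z. Df z h)"
    using assms(1) unfolding C1_on_def by blast
  obtain Dg where Dg: "\<And>z. z \<in> U \<Longrightarrow> (g has_derivative Dg z) (at z)"
      "\<And>h. continuous_on U (\<lambda>z. Dg z h)"
    using assms(2) unfolding C1_on_def by blast
  show ?thesis
    unfolding C1_on_def
    by (rule exI[of _ "\<lambda>z h. f z *\<^sub>R Dg z h + Df z h *\<^sub>R g z"])
       (auto intro!: has_derivative_scaleR continuous_on_add continuous_on_scaleR Df Dg
          assms[THEN C1_on_imp_continuous_on])
qed

lemma C2_on_imp_C1_on:
  assumes "C2_on U f" shows "C1_on U f"
proof -
  obtain G where G: "\<And>z. z \<in> U \<Longrightarrow> GDERIV f z :> G z" "C1_on U G"
    using assms unfolding C2_on_def by blast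
  show ?thesis
    unfolding C1_on_def
    by (rule exI[of _ "\<lambda>z h. h \<bullet> G z"])
       (use G in \<open>auto simp: gderiv_def intro!: continuous_on_inner continuous_on_const
          C1_on_imp_continuous_on[OF G(2)]\<close>)
qed

lemma C2_on_const: "C2_on U (\<lambda>z. c)"
  unfolding C2_on_def by (intro exI[of _ "\<lambda>z. 0"] conjI ballI GDERIV_const C1_on_const)

lemma C2_on_inner: "C2_on U (\<lambda>z. z \<bullet> a)"
  unfolding C2_on_def
  by (rule exI[of _ "\<lambda>z. a"])
     (auto simp: gderiv_def intro!: C1_on_const derivative_eq_intros)

lemma C2_on_nth: "C2_on U (\<lambda>z::real ^ 'n. z $ i)"
  using C2_on_inner[of U "axis i 1"] by (simp add: inner_axis)

lemma C2_on_add: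
  assumes "C2_on U f" "C2_on U g" shows "C2_on U (\<lambda>z. f z + g z)"
proof -
  obtain F where F: "\<And>z. z \<in> U \<Longrightarrow> GDERIV f z :> F z" "C1_on U F"
    using assms(1) unfolding C2_on_def by blast
  obtain G where G: "\<And>z. z \<in> U \<Longrightarrow> GDERIV g z :> G z" "C1_on U G"
    using assms(2) unfolding C2_on_def by blast
  show ?thesis
    unfolding C2_on_def
    by (rule exI[of _ "\<lambda>z. F z + G z"]) (intro conjI ballI GDERIV_add C1_on_add F G)
qed

lemma C2_on_mult:
  assumes "C2_on U f" "C2_on U g" shows "C2_on U (\<lambda>z. f z * g z)"
proof -
  obtain F where F: "\<And>z. z \<in> U \<Longrightarrow> GDERIV f z :> F z" "C1_on U F"
    using assms(1) unfolding C2_on_def by blast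
  obtain G where G: "\<And>z. z \<in> U \<Longrightarrow> GDERIV g z :> G z" "C1_on U G"
    using assms(2) unfolding C2_on_def by blast
  show ?thesis
    unfolding C2_on_def
    by (rule exI[of _ "\<lambda>z. f z *\<^sub>R G z + g z *\<^sub>R F z"])
       (intro conjI ballI GDERIV_mult C1_on_add C1_on_scaleR C2_on_imp_C1_on assms F G)
qed

lemma C2_on_diff:
  assumes "C2_on U f" "C2_on U g" shows "C2_on U (\<lambda>z. f z - g z)"
  using C2_on_add[OF assms(1) C2_on_mult[OF C2_on_const[of U "-1"] assms(2)]] by simp

lemma C2_on_power2:
  assumes "C2_on U f" shows "C2_on U (\<lambda>z. (f z)\<^sup>2)"
  using C2_on_mult[OF assms assms] by (simp add: power2_eq_square)

lemma C2_on_powr: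
  assumes f: "C2_on U f" and pos: "\<And>z. z \<in> U \<Longrightarrow> f z > 0"
  shows "C2_on U (\<lambda>z. f z powr r)"
proof -
  obtain F where F: "\<And>z. z \<in> U \<Longrightarrow> GDERIV f z :> F z" "C1_on U F"
    using f unfolding C2_on_def by blast
  have d: "((\<lambda>x. x powr a) has_real_derivative a * f z powr (a - 1)) (at (f z))"
    if "z \<in> U" for a z
    using pos[OF that] by (rule has_real_derivative_powr)
  have g: "GDERIV (\<lambda>z. f z powr a) z :> (a * f z powr (a - 1)) *\<^sub>R F z" if "z \<in> U" for a z
    using GDERIV_DERIV_compose[OF F(1)[OF that] d[OF that]] .
  \<comment> \<open>The exponent is arbitrary because these facts are also needed for \<open>r - 1\<close> and \<open>r - 2\<close>.\<close>
  have cont: "continuous_on U (\<lambda>z. f z powr a)" for a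
    using C1_on_imp_continuous_on[OF C2_on_imp_C1_on[OF f]] pos
    by (intro continuous_on_powr continuous_intros) (auto simp: less_imp_neq[symmetric])
  have C1: "C1_on U (\<lambda>z. f z powr a)" for a
    unfolding C1_on_def
    by (rule exI[of _ "\<lambda>z h. h \<bullet> ((a * f z powr (a - 1)) *\<^sub>R F z)"])
       (use g cont C1_on_imp_continuous_on[OF F(2)] in
         \<open>auto simp: gderiv_def intro!: continuous_on_mult continuous_on_const continuous_on_inner\<close>)
  have "C1_on U (\<lambda>z. (r *\<^sub>R f z powr (r - 1)) *\<^sub>R F z)"
    by (intro C1_on_scaleR C1_on_const C1 F)
  then show ?thesis
    unfolding C2_on_def using g by (intro exI[of _ "\<lambda>z. (r *\<^sub>R f z powr (r - 1)) *\<^sub>R F z"]) simp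
qed

lemma C2_on_transform_open:
  assumes "C2_on U f" "open U" "\<And>z. z \<in> U \<Longrightarrow> f z = g z"
  shows "C2_on U g"
proof -
  have "GDERIV g z :> G" if "GDERIV f z :> G" "z \<in> U" for z G
    using that assms(2,3) unfolding gderiv_def by (metis has_derivative_transform_within_open)
  then show ?thesis
    using assms(1) unfolding C2_on_def by blast
qed

text \<open>
  Dividing by \<open>sqrt g\<close> is multiplying by \<open>g powr (-1/2)\<close>, but only where \<open>g\<close> is positive. The two functions
  may differ outside \<open>U\<close>, which is why \<open>U\<close> has to be open.
\<close>

lemma C2_on_divide_sqrt:
  assumes "C2_on U f" "C2_on U g" "\<And>z. z \<in> U \<Longrightarrow> g z > 0" "open U"
  shows "C2_on U (\<lambda>z. f z / sqrt (g z))"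
proof (rule C2_on_transform_open[OF _ assms(4)])
  show "C2_on U (\<lambda>z. f z * g z powr (- (1/2)))"
    by (intro C2_on_mult C2_on_powr assms)
  show "f z * g z powr (- (1/2)) = f z / sqrt (g z)" if "z \<in> U" for z
    using assms(3)[OF that] by (simp add: powr_minus_divide powr_half_sqrt)
qed

lemma gradient_eq_if_GDERIV:
  fixes f :: "real ^ 'n \<Rightarrow> real"
  assumes "GDERIV f z :> G" shows "gradient f z = G"
proof -
  have "frechet_derivative f (at z) = (\<lambda>h. h \<bullet> G)"
    using assms unfolding gderiv_def by (metis frechet_derivative_at)
  then show ?thesis
    by (simp add: gradient_def vec_eq_iff inner_axis')
qed

text \<open>
  The gradient and the Hessian are defined pointwise from Frechet derivatives and mean something only
  where those exist. On an open set they agree with the gradient field and its derivative that witness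
  \<open>C2_on\<close>.
\<close>

lemma C2_on_hessian:
  fixes f :: "real ^ 'n \<Rightarrow> real"
  assumes "C2_on U f" "open U"
  shows "z \<in> U \<Longrightarrow> (gradient f has_derivative (*v) (hessian f z)) (at z)"
    and "continuous_on U (hessian f)"
proof -
  obtain G where G: "\<And>z. z \<in> U \<Longrightarrow> GDERIV f z :> G z" "C1_on U G"
    using assms unfolding C2_on_def by blast
  obtain D where D: "\<And>z. z \<in> U \<Longrightarrow> (G has_derivative D z) (at z)"
      "\<And>h. continuous_on U (\<lambda>z. D z h)"
    using G(2) unfolding C1_on_def by blast
  have der: "(gradient f has_derivative D z) (at z)" if "z \<in> U" for z
    using D(1)[OF that] assms(2) that
    by (rule has_derivative_transform_within_open) (simp add: gradient_eq_if_GDERIV[OF G(1)])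
  show "(gradient f has_derivative (*v) (hessian f z)) (at z)" if "z \<in> U" for z
    unfolding hessian_def using der[OF that] by (metis differentiable_def jacobian_works)
  have entry: "hessian f z $ i $ j = D z (axis j 1) $ i" if "z \<in> U" for z i j
    unfolding hessian_def jacobian_def matrix_def
    using frechet_derivative_at[OF der[OF that]] by simp
  have "continuous_on U (\<lambda>z. \<chi> i j. D z (axis j 1) $ i)"
    by (intro continuous_on_vec_lambda continuous_on_component D)
  then show "continuous_on U (hessian f)"
    by (rule continuous_on_eq) (simp add: vec_eq_iff entry)
qed

section \<open>Uniqueness for linear differential equations\<close>

text \<open>
  Gronwall's argument in both time directions: \<open>|u|\<^sup>2\<close> changes at a rate of at most \<open>2M |u|\<^sup>2\<close>, so
  \<open>|u(s)|\<^sup>2 exp(-2Ms)\<close> cannot increase forwards, \<open>|u(s)|\<^sup>2 exp(2Ms)\<close> cannot increase backwards, and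
  both start from zero.
\<close>

lemma bounded_growth_imp_zero:
  fixes u :: "real \<Rightarrow> 'a::real_inner"
  assumes der: "\<And>s. (u has_vector_derivative u' s) (at s)"
    and bound: "\<And>s. s \<in> closed_segment a b \<Longrightarrow> norm (u' s) \<le> M * norm (u s)"
    and "u a = 0"
  shows "u b = 0"
proof -
  have dir: "\<bar>u s \<bullet> u' s\<bar> \<le> M * (u s \<bullet> u s)" if "s \<in> closed_segment a b" for s
  proof -
    have "\<bar>u s \<bullet> u' s\<bar> \<le> norm (u s) * norm (u' s)"
      by (rule Cauchy_Schwarz_ineq2)
    also have "\<dots> \<le> norm (u s) * (M * norm (u s))"
      using bound[OF that] by (intro mult_left_mono) auto
    also have "\<dots> = M * (u s \<bullet> u s)"
      by (simp add: power2_norm_eq_inner[symmetric] power2_eq_square)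
    finally show ?thesis .
  qed
  have der_g: "((\<lambda>s. (u s \<bullet> u s) * exp (c * s)) has_real_derivative
      (2 * (u s \<bullet> u' s) + c * (u s \<bullet> u s)) * exp (c * s)) (at s)" for c s
  proof -
    have "((\<lambda>s. u s \<bullet> u s) has_real_derivative 2 * (u s \<bullet> u' s)) (at s)"
      using has_derivative_inner[OF der[of s, unfolded has_vector_derivative_def]
          der[of s, unfolded has_vector_derivative_def]]
      unfolding has_field_derivative_def
      by (rule has_derivative_eq_rhs) (auto simp: fun_eq_iff inner_commute algebra_simps)
    then show ?thesis
      by (auto intro!: derivative_eq_intros simp: algebra_simps)
  qed
  have "(u b \<bullet> u b) * exp (c * b) \<le> 0" if c: "c = (if a \<le> b then - 2 * M else 2 * M)" for c
  proof (cases "a \<le> b")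
    case True
    have "(u b \<bullet> u b) * exp (c * b) \<le> (u a \<bullet> u a) * exp (c * a)"
    proof (rule DERIV_nonpos_imp_nonincreasing[OF True, where f = "\<lambda>s. (u s \<bullet> u s) * exp (c * s)"])
      fix s assume "a \<le> s" "s \<le> b"
      then have "2 * (u s \<bullet> u' s) + c * (u s \<bullet> u s) \<le> 0"
        using dir[of s] True c by (auto simp: closed_segment_eq_real_ivl)
      then show "\<exists>y. ((\<lambda>s. (u s \<bullet> u s) * exp (c * s)) has_real_derivative y) (at s) \<and> y \<le> 0"
        using der_g[of c s] by (meson exp_ge_zero mult_nonpos_nonneg)
    qed
    then show ?thesis using assms(3) by simp
  next
    case False
    have "(u b \<bullet> u b) * exp (c * b) \<le> (u a \<bullet> u a) * exp (c * a)"
    proof (rule DERIV_nonneg_imp_nondecreasing[where f = "\<lambda>s. (u s \<bullet> u s) * exp (c * s)"])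
      fix s assume "b \<le> s" "s \<le> a"
      then have "0 \<le> 2 * (u s \<bullet> u' s) + c * (u s \<bullet> u s)"
        using dir[of s] False c by (auto simp: closed_segment_eq_real_ivl)
      then show "\<exists>y. ((\<lambda>s. (u s \<bullet> u s) * exp (c * s)) has_real_derivative y) (at s) \<and> 0 \<le> y"
        using der_g[of c s] by (meson exp_ge_zero mult_nonneg_nonneg)
    qed (use False in auto)
    then show ?thesis using assms(3) by simp
  qed
  from this[OF refl] have "u b \<bullet> u b \<le> 0"
    by (simp only: mult_le_0_iff not_exp_le_zero exp_ge_zero simp_thms)
  then show ?thesis
    by (metis inner_eq_zero_iff inner_ge_zero order_antisym)
qed

lemma linear_ode_zero:
  fixes A :: "real \<Rightarrow> real ^ 'n ^ 'n"
  assumes cont: "continuous_on UNIV A"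
    and der: "\<And>s. (u has_vector_derivative A s *v u s) (at s)"
    and zero: "u a = 0"
  shows "u b = 0"
proof -
  have "continuous_on (closed_segment a b) (\<lambda>s. \<Sum>i\<in>UNIV. \<Sum>j\<in>UNIV. \<bar>A s $ i $ j\<bar>)"
    by (intro continuous_intros continuous_on_subset[OF cont]) auto
  then have "bounded ((\<lambda>s. \<Sum>i\<in>UNIV. \<Sum>j\<in>UNIV. \<bar>A s $ i $ j\<bar>) ` closed_segment a b)"
    by (intro compact_imp_bounded compact_continuous_image) auto
  then obtain M where M: "\<And>s. s \<in> closed_segment a b \<Longrightarrow> (\<Sum>i\<in>UNIV. \<Sum>j\<in>UNIV. \<bar>A s $ i $ j\<bar>) \<le> M"
    unfolding bounded_iff by (auto dest!: abs_le_D1)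
  have "norm (A s *v u s) \<le> M * norm (u s)" if "s \<in> closed_segment a b" for s
  proof -
    have "norm (A s *v u s) \<le> onorm ((*v) (A s)) * norm (u s)"
      by (intro onorm matrix_vector_mul_bounded_linear)
    also have "\<dots> \<le> M * norm (u s)"
      using onorm_le_matrix_component_sum[of "A s"] M[OF that] by (intro mult_right_mono) auto
    finally show ?thesis .
  qed
  then show ?thesis
    using bounded_growth_imp_zero[OF der _ zero] by blast
qed

lemma linear_ode_unique:
  fixes A :: "real \<Rightarrow> real ^ 'n ^ 'n"
  assumes cont: "continuous_on UNIV A"
    and u: "\<And>s. (u has_vector_derivative A s *v u s) (at s)"
    and v: "\<And>s. (v has_vector_derivative A s *v v s) (at s)"
    and eq: "u a = v a"
  shows "u b = v b"
proof -
  have "((\<lambda>s. u s - v s) has_vector_derivative A s *v (u s - v s)) (at s)" for s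
    using has_vector_derivative_diff[OF u v] by (simp add: matrix_vector_mult_diff_distrib)
  from linear_ode_zero[where u = "\<lambda>s. u s - v s", OF cont this, of a b] eq show ?thesis
    by simp
qed

lemma fundamental_matrix_column:
  fixes A Y :: "real \<Rightarrow> real ^ 'n ^ 'n"
  assumes "(Y has_vector_derivative A s ** Y s) (at s)"
  shows "((\<lambda>s. Y s *v x) has_vector_derivative A s *v (Y s *v x)) (at s)"
proof -
  have "bounded_linear (\<lambda>M::real ^ 'n ^ 'n. M *v x)"
    by (auto intro!: linear_conv_bounded_linear[THEN iffD1] linearI
      simp: matrix_vector_mult_add_rdistrib scaleR_matrix_vector_assoc)
  from bounded_linear.has_vector_derivative[OF this assms] show ?thesis
    by (simp add: matrix_vector_mul_assoc)
qed

text \<open>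
  A vector in the kernel of \<open>Y b\<close> gives a solution that vanishes at \<open>b\<close>, hence also at \<open>a\<close>.
\<close>

lemma fundamental_matrix_invertible:
  fixes A Y :: "real \<Rightarrow> real ^ 'n ^ 'n"
  assumes "continuous_on UNIV A"
    and "\<And>s. (Y has_vector_derivative A s ** Y s) (at s)"
    and "invertible (Y a)"
  shows "invertible (Y b)"
proof -
  have "x = 0" if "Y b *v x = 0" for x
  proof -
    have "((\<lambda>s. Y s *v x) has_vector_derivative A s *v (Y s *v x)) (at s)" for s
      by (rule fundamental_matrix_column[OF assms(2)])
    from linear_ode_zero[OF assms(1) this that, of a] have "Y a *v x = 0" .
    then show ?thesis
      using assms(3) by (metis invertible_left_inverse matrix_left_invertible_ker)
  qed
  then show ?thesis
    by (metis invertible_left_inverse matrix_left_invertible_ker)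
qed

lemma matrix_inv_vector_eq:
  fixes A :: "real ^ 'n ^ 'n"
  assumes "invertible A" "A *v x = y"
  shows "matrix_inv A *v y = x"
proof -
  have "matrix_inv A ** A = mat 1"
    using assms(1) unfolding invertible_def matrix_inv_def by (rule someI2_ex) simp
  then show ?thesis
    using assms(2) by (metis matrix_vector_mul_assoc matrix_vector_mul_lid)
qed

section \<open>Coordinates and the matrices J, S and Y0\<close>

lemma vector_4 [simp]:
  "(vector [a, b, c, d] :: 'a::zero ^ 4) $ 1 = a"
  "(vector [a, b, c, d] :: 'a::zero ^ 4) $ 2 = b"
  "(vector [a, b, c, d] :: 'a::zero ^ 4) $ 3 = c"
  "(vector [a, b, c, d] :: 'a::zero ^ 4) $ 4 = d"
  unfolding vector_def by auto

lemma sum_phase_index: "sum f (UNIV :: (4 + 4) set) = (\<Sum>i\<in>UNIV. f (Inl i)) + (\<Sum>i\<in>UNIV. f (Inr i))"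
  unfolding UNIV_Plus_UNIV[symmetric] by (subst sum.Plus) auto

lemma all_phase_index: "(\<forall>i::4+4. R i) \<longleftrightarrow> (\<forall>i. R (Inl i)) \<and> (\<forall>i. R (Inr i))"
  by (metis sum.exhaust)

lemma phase_eq_iff:
  "(x::phase) = y \<longleftrightarrow> (\<forall>i. Q i x = Q i y) \<and> (\<forall>i. P i x = P i y)"
  by (auto simp: vec_eq_iff all_phase_index)

lemma J_component:
  "Q i (J *v x) = P i x" "P i (J *v x) = - Q i x"
  by (simp_all add: J_def block_matrix_def matrix_vector_mult_def sum_phase_index mat_def sum_negf
      if_distrib[where f = "\<lambda>t. t * _"] cong: if_cong)

lemma S_component:
  "Q 1 (S *v x) = - Q 1 x" "Q 2 (S *v x) = Q 2 x" "Q 3 (S *v x) = - Q 3 x" "Q 4 (S *v x) = Q 4 x"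
  "P 1 (S *v x) = P 1 x" "P 2 (S *v x) = - P 2 x" "P 3 (S *v x) = P 3 x" "P 4 (S *v x) = - P 4 x"
  by (simp_all add: S_def diag_matrix_def phase_point_def matrix_vector_mult_def
      if_distrib[where f = "\<lambda>t. t * _"] cong: if_cong)

lemma Y0_component:
  "Q 1 (Y0 *v x) = P 1 x" "Q 2 (Y0 *v x) = Q 3 x" "Q 3 (Y0 *v x) = P 2 x" "Q 4 (Y0 *v x) = Q 4 x"
  "P 1 (Y0 *v x) = - Q 1 x" "P 2 (Y0 *v x) = P 3 x" "P 3 (Y0 *v x) = - Q 2 x" "P 4 (Y0 *v x) = P 4 x"
  by (simp_all add: Y0_def Y0_column_def matrix_vector_mult_def sum_phase_index sum_4 axis_def)

lemma invertible_Y0: "invertible Y0"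
proof -
  have "x = 0" if "Y0 *v x = 0" for x
    using that by (simp add: phase_eq_iff forall_4 Y0_component)
  then show ?thesis
    by (metis invertible_left_inverse matrix_left_invertible_ker)
qed

lemma Y0_eP: "Y0 *v eP 1 = eQ 1"
  by (simp add: phase_eq_iff forall_4 Y0_component) (simp add: axis_def)

lemma S_eQ: "S *v eQ 1 = - eQ 1"
  by (simp add: phase_eq_iff forall_4 S_component) (simp add: axis_def)

section \<open>Smoothness of the Hamiltonian\<close>

lemma open_Gamma_dom: "open (Gamma_dom m1 m2)"
  unfolding Gamma_dom_def radicand_plus_def radicand_minus_def bQ_def
  by (intro open_Collect_conj open_Collect_less continuous_intros)

text \<open>
  The cofactor of \<open>Q_1\<^sup>2 + Q_2\<^sup>2\<close> in \<open>\<Gamma>\<close>, split off so that the product rule gives the gradient of \<open>\<Gamma>\<close>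
  at \<open>Q_1 = Q_2 = 0\<close>.
\<close>

definition Gamma_factor :: "real \<Rightarrow> real \<Rightarrow> real \<Rightarrow> phase \<Rightarrow> real" where
  "Gamma_factor m1 m2 E z =
     ((P 3 z)\<^sup>2 + (P 4 z)\<^sup>2) * (1 / m1 + 2 / m2)
     - m1 * m2 / sqrt (radicand_plus m1 m2 z) - m1 * m2 / sqrt (radicand_minus m1 m2 z) - E"

lemma Gamma_split:
  "Gamma m1 m2 E = (\<lambda>z. ((P 1 z)\<^sup>2 + (P 2 z)\<^sup>2) * (1 / (4 * m1))
     + ((Q 1 z)\<^sup>2 + (Q 2 z)\<^sup>2) * Gamma_factor m1 m2 E z - m1\<^sup>2)"
  by (simp add: fun_eq_iff Gamma_def Gamma_factor_def algebra_simps add_divide_distrib diff_divide_distrib)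

lemma C2_on_Gamma_factor: "C2_on (Gamma_dom m1 m2) (Gamma_factor m1 m2 E)"
proof -
  note intros = C2_on_add C2_on_diff C2_on_mult C2_on_power2 C2_on_nth C2_on_const
  have "C2_on (Gamma_dom m1 m2) (radicand_plus m1 m2)"
    unfolding radicand_plus_def bQ_def by (intro intros)
  moreover have "C2_on (Gamma_dom m1 m2) (radicand_minus m1 m2)"
    unfolding radicand_minus_def bQ_def by (intro intros)
  ultimately show ?thesis
    unfolding Gamma_factor_def
    by (intro intros C2_on_divide_sqrt open_Gamma_dom) (auto simp: Gamma_dom_def)
qed

lemma C2_on_Gamma: "C2_on (Gamma_dom m1 m2) (Gamma m1 m2 E)"
  unfolding Gamma_split
  by (intro C2_on_add C2_on_diff C2_on_mult C2_on_power2 C2_on_nth C2_on_const C2_on_Gamma_factor)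

text \<open>
  At such a point \<open>Q_1\<^sup>2 + Q_2\<^sup>2\<close> and its derivative both vanish, so by the product rule its product
  with the differentiable function \<open>Gamma_factor\<close> contributes nothing, and the kinetic term remains.
\<close>

lemma gradient_Gamma_where_Q1_Q2_zero:
  assumes "m1 \<noteq> 0" "z \<in> Gamma_dom m1 m2" "Q 1 z = 0" "Q 2 z = 0"
  shows "gradient (Gamma m1 m2 E) z = (P 1 z / (2 * m1)) *\<^sub>R eP 1 + (P 2 z / (2 * m1)) *\<^sub>R eP 2"
proof -
  obtain R where "GDERIV (Gamma_factor m1 m2 E) z :> R"
    using C2_on_Gamma_factor assms(2) unfolding C2_on_def by blast
  then have "(Gamma_factor m1 m2 E has_derivative (\<lambda>h. h \<bullet> R)) (at z)"
    unfolding gderiv_def .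
  moreover have "((\<lambda>z::phase. z $ i) has_derivative (\<lambda>h. h $ i)) (at z)" for i
    by (intro bounded_linear_imp_has_derivative bounded_linear_vec_nth)
  ultimately have "GDERIV (Gamma m1 m2 E) z :>
      (P 1 z / (2 * m1)) *\<^sub>R eP 1 + (P 2 z / (2 * m1)) *\<^sub>R eP 2"
    unfolding gderiv_def Gamma_split using assms(1,3,4)
    by (auto intro!: derivative_eq_intros simp: inner_add_right inner_axis field_simps)
  then show ?thesis
    by (rule gradient_eq_if_GDERIV)
qed

section \<open>The velocity along a solution\<close>

text \<open>
  The vector field does not depend on time, so differentiating \<open>\<gamma>' = J \<nabla>\<Gamma>(\<gamma>)\<close> once more by the chain
  rule shows that the velocity solves the linearized equation.
\<close>

lemma hamiltonian_velocity_linearized: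
  assumes "hamiltonian_solution m1 m2 E \<gamma>"
  shows "((\<lambda>s. J *v gradient (Gamma m1 m2 E) (\<gamma> s)) has_vector_derivative
      (J ** hessian (Gamma m1 m2 E) (\<gamma> s)) *v (J *v gradient (Gamma m1 m2 E) (\<gamma> s))) (at s)"
proof -
  have "\<gamma> s \<in> Gamma_dom m1 m2"
    and vel: "(\<gamma> has_vector_derivative J *v gradient (Gamma m1 m2 E) (\<gamma> s)) (at s)"
    using assms unfolding hamiltonian_solution_def by auto
  then have "(gradient (Gamma m1 m2 E) has_derivative (*v) (hessian (Gamma m1 m2 E) (\<gamma> s))) (at (\<gamma> s))"
    by (intro C2_on_hessian(1)[OF C2_on_Gamma open_Gamma_dom])
  from vector_derivative_diff_chain_within[OF vel has_derivative_at_withinI[OF this]]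
  have "((\<lambda>s. gradient (Gamma m1 m2 E) (\<gamma> s)) has_vector_derivative
      hessian (Gamma m1 m2 E) (\<gamma> s) *v (J *v gradient (Gamma m1 m2 E) (\<gamma> s))) (at s)"
    by (simp add: o_def)
  from bounded_linear.has_vector_derivative[OF matrix_vector_mul_bounded_linear[of J] this]
  show ?thesis by (simp add: matrix_vector_mul_assoc matrix_mul_assoc)
qed

lemma continuous_hessian_along:
  assumes "hamiltonian_solution m1 m2 E \<gamma>"
  shows "continuous_on UNIV (\<lambda>s. J ** hessian (Gamma m1 m2 E) (\<gamma> s))"
proof -
  have "continuous_on UNIV \<gamma>"
    using assms unfolding hamiltonian_solution_def
    by (meson continuous_at_imp_continuous_on has_vector_derivative_continuous)
  moreover have "\<gamma> ` UNIV \<subseteq> Gamma_dom m1 m2"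
    using assms unfolding hamiltonian_solution_def by auto
  ultimately have "continuous_on UNIV (\<lambda>s. hessian (Gamma m1 m2 E) (\<gamma> s))"
    using continuous_on_compose2[OF C2_on_hessian(2)[OF C2_on_Gamma open_Gamma_dom]] by blast
  then have "continuous_on UNIV (\<lambda>s. \<chi> i j. \<Sum>k\<in>UNIV. J $ i $ k * hessian (Gamma m1 m2 E) (\<gamma> s) $ k $ j)"
    by (intro continuous_intros)
  then show ?thesis
    unfolding matrix_matrix_mult_def .
qed

text \<open>
  The minus sign of the symmetry cancels the one produced by reversing time about \<open>c\<close>.
\<close>

lemma velocity_fixed_by_reflection:
  fixes A :: "real ^ 'n ^ 'n"
  assumes der: "\<And>s. (\<gamma> has_vector_derivative v s) (at s)"
    and "\<And>s. \<gamma> s = - (A *v \<gamma> (2 * c - s))"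
  shows "A *v v c = v c"
proof -
  have "((\<lambda>s. 2 * c - s) has_vector_derivative - 1) (at c)"
    by (auto intro!: derivative_eq_intros)
  moreover have "(\<gamma> has_vector_derivative v c) (at (2 * c - c))"
    using der[of c] by simp
  ultimately have "((\<lambda>s. \<gamma> (2 * c - s)) has_vector_derivative - v c) (at c)"
    using vector_diff_chain_at[of "\<lambda>s. 2 * c - s" "- 1" c \<gamma> "v c"] by (simp add: o_def)
  from has_vector_derivative_minus[OF
      bounded_linear.has_vector_derivative[OF matrix_vector_mul_bounded_linear[of A] this]]
  have "((\<lambda>s. - (A *v \<gamma> (2 * c - s))) has_vector_derivative A *v v c) (at c)"
    by (simp add: linear_neg[OF matrix_vector_mul_linear])
  moreover have "(\<lambda>s. - (A *v \<gamma> (2 * c - s))) = \<gamma>"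
    by (rule ext) (rule assms(2)[symmetric])
  ultimately show ?thesis
    using der[of c] by (metis vector_derivative_at)
qed

section \<open>The eigenvector of K\<close>

theorem theorem3p10:
  fixes m1 m2 E T :: real
    and \<gamma> :: "real \<Rightarrow> phase"
    and Y :: "real \<Rightarrow> mat8"
  assumes "m1 > 0" and "m2 > 0" and "2 * m1 + m2 = 3" and "E < 0"
    and "broucke_orbit m1 m2 E T \<gamma>"
    and "linearized_solution m1 m2 E \<gamma> Y"
  shows "right_eigenvector (K_matrix (Y (T/4))) (vector [1, 0, 0, 0]) (- 1)"
proof -
  define A where "A = (\<lambda>s. J ** hessian (Gamma m1 m2 E) (\<gamma> s))"
  define v where "v = (\<lambda>s. J *v gradient (Gamma m1 m2 E) (\<gamma> s))"
  \<comment> \<open>The value of \<open>P_1 / (2 m_1)\<close> at time \<open>0\<close>, which is the velocity of \<open>Q_1\<close> there.\<close>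
  define c where "c = 2 * m1 powr (3/2) / (2 * m1)"
  define B where "B = Y (T/4)"
  have ham: "hamiltonian_solution m1 m2 E \<gamma>"
    using assms(5) unfolding broucke_orbit_def by blast
  have A_cont: "continuous_on UNIV A"
    unfolding A_def by (rule continuous_hessian_along[OF ham])
  have Y: "Y 0 = Y0" "\<And>s. (Y has_vector_derivative A s ** Y s) (at s)"
    using assms(6) unfolding linearized_solution_def A_def by auto
  have "c \<noteq> 0"
    using assms(1) by (simp add: c_def)
  obtain \<zeta>4 where \<gamma>0: "\<gamma> 0 = phase_point (vector [0, 0, 0, \<zeta>4]) (vector [2 * m1 powr (3/2), 0, 0, 0])"
    using assms(5) unfolding broucke_orbit_def by blast
  have "gradient (Gamma m1 m2 E) (\<gamma> 0) = c *\<^sub>R eP 1"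
  proof -
    have "Q 1 (\<gamma> 0) = 0" "Q 2 (\<gamma> 0) = 0" "P 1 (\<gamma> 0) = 2 * m1 powr (3/2)" "P 2 (\<gamma> 0) = 0"
      by (simp_all add: \<gamma>0 phase_point_def)
    moreover have "\<gamma> 0 \<in> Gamma_dom m1 m2"
      using ham unfolding hamiltonian_solution_def by blast
    ultimately show ?thesis
      using gradient_Gamma_where_Q1_Q2_zero[of m1 "\<gamma> 0" m2 E] assms(1) by (simp add: c_def)
  qed
  then have v0: "v 0 = c *\<^sub>R eQ 1"
    unfolding v_def by (simp add: phase_eq_iff J_component) (simp add: axis_def)
  have "v (T/4) = Y (T/4) *v (c *\<^sub>R eP 1)"
  proof (rule linear_ode_unique[OF A_cont, where u = v and v = "\<lambda>s. Y s *v (c *\<^sub>R eP 1)"])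
    show "(v has_vector_derivative A s *v v s) (at s)" for s
      unfolding v_def A_def by (rule hamiltonian_velocity_linearized[OF ham])
    show "((\<lambda>s. Y s *v (c *\<^sub>R eP 1)) has_vector_derivative A s *v (Y s *v (c *\<^sub>R eP 1))) (at s)" for s
      by (rule fundamental_matrix_column[OF Y(2)])
    show "v 0 = Y 0 *v (c *\<^sub>R eP 1)"
      by (simp add: v0 Y(1) Y0_eP matrix_vector_mult_scaleR)
  qed
  moreover have "S *v v (T/4) = v (T/4)"
  proof (rule velocity_fixed_by_reflection)
    show "(\<gamma> has_vector_derivative v s) (at s)" for s
      using ham unfolding hamiltonian_solution_def v_def by blast
    show "\<gamma> s = - (S *v \<gamma> (2 * (T/4) - s))" for s
    proof -
      have "2 * (T/4) = T/2" by simp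
      moreover have "\<gamma> s = - (S *v \<gamma> (T/2 - s))"
        using assms(5) unfolding broucke_orbit_def by blast
      ultimately show ?thesis by (rule ssubst)
    qed
  qed
  ultimately have SB: "S *v (B *v eP 1) = B *v eP 1"
    using \<open>c \<noteq> 0\<close> by (simp add: B_def matrix_vector_mult_scaleR)
  have "invertible B"
    unfolding B_def by (rule fundamental_matrix_invertible[OF A_cont Y(2), of 0]) (simp add: Y(1) invertible_Y0)
  have "matrix_inv B *v (B *v eP 1) = eP 1"
    using \<open>invertible B\<close> by (rule matrix_inv_vector_eq) simp
  moreover have "matrix_inv Y0 *v (- eQ 1) = - eP 1"
    using invertible_Y0 by (rule matrix_inv_vector_eq) (simp add: Y0_eP linear_neg[OF matrix_vector_mul_linear])
  ultimately have "W_matrix B *v eP 1 = - eP 1"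
    by (simp only: W_matrix_def matrix_vector_mul_assoc[symmetric] SB Y0_eP S_eQ)
  then have col: "W_matrix B $ i $ Inr 1 = - eP 1 $ i" for i
    unfolding matrix_vector_mult_basis by (simp add: column_def vec_eq_iff)
  have "K_matrix B *v vector [1, 0, 0, 0] = - vector [1, 0, 0, 0]"
    by (simp add: vec_eq_iff forall_4 matrix_vector_mult_def sum_4 K_matrix_def lower_right_block_def col)
      (simp add: axis_def)
  moreover have "(vector [1, 0, 0, 0] :: real ^ 4) \<noteq> 0"
    by (simp add: vec_eq_iff forall_4)
  ultimately show ?thesis
    unfolding right_eigenvector_def B_def scaleR_minus1_left by blast
qed

end
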